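(* Let $\hat\varphi$ be the (unique) fixed point of $S$. Then $0\le\hat\varphi_i(\tau)\le f_i(\tau)$ for all $i\in V$ and $\tau\in L$.
   Context: Let $G=(V,E)$ be an undirected, simple, connected graph with $V=\{1,\dots,n\}$, $n\ge 2$. For $i\in V$ let $N(i)=\{j\in V:\{i,j\}\in E\}$. Let $L$ be a finite set of labels. For each $i\in V$ let $g_i:L\to[0,\infty)$, and for each $\{i,j\}\in E$ let $h_{ij},h_{ji}:L^2\to[0,\infty)$ with $h_{ij}(a,b)=h_{ji}(b,a)$. The energy $F:L^V\to\mathbb R$ is $F(x)=\sum_{i\in V}g_i(x_i)+\sum_{\{i,j\}\in E}h_{ij}(x_i,x_j)$, and the value functions are $f_i(\tau)=\min\{F(x): x\in L^V,\ x_i=\tau\}$. Fix $p\in(0,1)$, $q=1-p$, and weights $w_{ij}\in[0,1]$ for $i\in V$, $j\in N(i)$, with $\sum_{j\in N(i)}w_{ij}=1$ for every $i\in V$. Let $\mathcal{F}$ be the set of tuples $\varphi=(\varphi_1,\dots,\varphi_n)$ with $\varphi_i:L\to\mathbb{R}$. The map $S:\mathcal F\to\mathcal F$ is defined by \[ (S\varphi)_i(\tau)=p\,g_i(\tau)+\sum_{j\in N(i)}w_{ij}\min_{u_j\in L}\Big(p\,h_{ij}(\tau,u_j)+q\,\varphi_j(u_j)\Big). \] (The map $S$ has a unique fixed point.) *)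

theory Defs
  imports Complex_Main "HOL-Library.FuncSet"
begin

definition simple_graph :: "nat set \<Rightarrow> nat set set \<Rightarrow> bool" where
  "simple_graph V E \<longleftrightarrow> (\<forall>e\<in>E. \<exists>i\<in>V. \<exists>j\<in>V. i \<noteq> j \<and> e = {i, j})"

definition connected_graph :: "nat set \<Rightarrow> nat set set \<Rightarrow> bool" where
  "connected_graph V E \<longleftrightarrow> (\<forall>i\<in>V. \<forall>j\<in>V. (i, j) \<in> {(a, b). {a, b} \<in> E}\<^sup>*)"

definition nbrs :: "nat set \<Rightarrow> nat set set \<Rightarrow> nat \<Rightarrow> nat set" where
  "nbrs V E i = {j \<in> V. {i, j} \<in> E}"

text \<open>
  Each undirected edge contributes once; it is represented by its ordered pair \<open>(i, j)\<close> with
  \<open>i < j\<close>. The choice of orientation is immaterial under the symmetry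
  \<open>h i j a b = h j i b a\<close>.
\<close>

definition energy ::
  "nat set \<Rightarrow> nat set set \<Rightarrow> (nat \<Rightarrow> 'l \<Rightarrow> real) \<Rightarrow> (nat \<Rightarrow> nat \<Rightarrow> 'l \<Rightarrow> 'l \<Rightarrow> real) \<Rightarrow>
   (nat \<Rightarrow> 'l) \<Rightarrow> real" where
  "energy V E g h x =
     (\<Sum>i\<in>V. g i (x i)) + (\<Sum>(i, j)\<in>{(i, j). i < j \<and> {i, j} \<in> E}. h i j (x i) (x j))"

definition value_fun ::
  "nat set \<Rightarrow> nat set set \<Rightarrow> 'l set \<Rightarrow> (nat \<Rightarrow> 'l \<Rightarrow> real) \<Rightarrow>
   (nat \<Rightarrow> nat \<Rightarrow> 'l \<Rightarrow> 'l \<Rightarrow> real) \<Rightarrow> nat \<Rightarrow> 'l \<Rightarrow> real" where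
  "value_fun V E L g h i \<tau> = Min {energy V E g h x | x. x \<in> V \<rightarrow>\<^sub>E L \<and> x i = \<tau>}"

text \<open>
  Tuples \<open>(\<phi>\<^sub>i)\<close> of functions \<open>L \<rightarrow> \<real>\<close> are extensional functions on \<open>V\<close> and \<open>L\<close>, so that equality
  of tuples is equality on these carriers.
\<close>

definition tuples :: "nat set \<Rightarrow> 'l set \<Rightarrow> (nat \<Rightarrow> 'l \<Rightarrow> real) set" where
  "tuples V L = V \<rightarrow>\<^sub>E (L \<rightarrow>\<^sub>E UNIV)"

definition S_map ::
  "nat set \<Rightarrow> nat set set \<Rightarrow> 'l set \<Rightarrow> (nat \<Rightarrow> 'l \<Rightarrow> real) \<Rightarrow>
   (nat \<Rightarrow> nat \<Rightarrow> 'l \<Rightarrow> 'l \<Rightarrow> real) \<Rightarrow> real \<Rightarrow> real \<Rightarrow> (nat \<Rightarrow> nat \<Rightarrow> real) \<Rightarrow>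
   (nat \<Rightarrow> 'l \<Rightarrow> real) \<Rightarrow> (nat \<Rightarrow> 'l \<Rightarrow> real)" where
  "S_map V E L g h p q w \<phi> =
     (\<lambda>i\<in>V. \<lambda>\<tau>\<in>L. p * g i \<tau> +
        (\<Sum>j\<in>nbrs V E i. w i j * Min ((\<lambda>u. p * h i j \<tau> u + q * \<phi> j u) ` L)))"

end

theory Submission
  imports Defs
begin

text \<open>
  The map \<open>S\<close> is monotone and multiplies additive constants by \<open>q < 1\<close>. Hence a subsolution
  \<open>\<phi> \<le> S \<phi>\<close> lies below every supersolution \<open>S \<psi> \<le> \<psi>\<close>: if \<open>c\<close> is the maximum of \<open>\<phi> - \<psi>\<close>, then
  \<open>\<phi> \<le> S \<phi> \<le> S (\<psi> + c) = S \<psi> + q c \<le> \<psi> + q c\<close>, so \<open>c \<le> q c\<close> and \<open>c \<le> 0\<close>. The zero tuple is a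
  subsolution because all costs are nonnegative. The value functions form a supersolution: if \<open>x\<close>
  attains \<open>f\<^sub>i(\<tau>)\<close>, choose \<open>u\<^sub>j = x\<^sub>j\<close> in every minimum and use \<open>f\<^sub>j(x\<^sub>j) \<le> F(x)\<close> and
  \<open>g\<^sub>i(x\<^sub>i) + h\<^sub>i\<^sub>j(x\<^sub>i, x\<^sub>j) \<le> F(x)\<close>.
\<close>

lemma weighted_average_le_add:
  fixes w a b :: "'i \<Rightarrow> 'a::linordered_semidom"
  assumes "\<And>j. j \<in> N \<Longrightarrow> 0 \<le> w j" and "(\<Sum>j\<in>N. w j) = 1"
    and "\<And>j. j \<in> N \<Longrightarrow> a j \<le> b j + c"
  shows "(\<Sum>j\<in>N. w j * a j) \<le> (\<Sum>j\<in>N. w j * b j) + c"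
proof -
  have "(\<Sum>j\<in>N. w j * a j) \<le> (\<Sum>j\<in>N. w j * (b j + c))"
    using assms(1,3) by (intro sum_mono mult_left_mono)
  also have "\<dots> = (\<Sum>j\<in>N. w j * b j) + (\<Sum>j\<in>N. w j) * c"
    by (simp add: distrib_left sum.distrib sum_distrib_right)
  finally show ?thesis
    using assms(2) by simp
qed

lemma Min_image_le_add:
  fixes f g :: "'i \<Rightarrow> 'a::linordered_ab_semigroup_add"
  assumes "finite A" and "A \<noteq> {}" and "\<And>u. u \<in> A \<Longrightarrow> f u \<le> g u + c"
  shows "Min (f ` A) \<le> Min (g ` A) + c"
proof -
  have "Min (g ` A) \<in> g ` A"
    using assms(1,2) by simp
  then obtain u where "u \<in> A" and "Min (g ` A) = g u"
    by blast
  moreover from \<open>u \<in> A\<close> have "Min (f ` A) \<le> f u"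
    using assms(1) by simp
  ultimately show ?thesis
    using assms(3) by (metis order_trans)
qed

lemma simple_graph_edgeD:
  assumes "simple_graph V E" and "{i, j} \<in> E"
  shows "i \<in> V" and "j \<in> V" and "i \<noteq> j"
  using assms unfolding simple_graph_def by (fastforce simp: doubleton_eq_iff)+

lemma S_map_apply:
  assumes "i \<in> V" and "\<tau> \<in> L"
  shows "S_map V E L g h p q w \<phi> i \<tau> =
    p * g i \<tau> + (\<Sum>j\<in>nbrs V E i. w i j * Min ((\<lambda>u. p * h i j \<tau> u + q * \<phi> j u) ` L))"
  using assms by (simp add: S_map_def)

locale averaging_weights =
  fixes V :: "nat set" and E :: "nat set set" and w :: "nat \<Rightarrow> nat \<Rightarrow> real"
  assumes weight_nonneg: "i \<in> V \<Longrightarrow> j \<in> nbrs V E i \<Longrightarrow> 0 \<le> w i j"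
    and sum_weights: "i \<in> V \<Longrightarrow> (\<Sum>j\<in>nbrs V E i. w i j) = 1"
begin

lemma S_map_le_add:
  assumes "finite L" and "0 \<le> q" and "i \<in> V" and "\<tau> \<in> L"
    and dominated: "\<And>j u. j \<in> V \<Longrightarrow> u \<in> L \<Longrightarrow> \<phi> j u \<le> \<psi> j u + c"
  shows "S_map V E L g h p q w \<phi> i \<tau> \<le> S_map V E L g h p q w \<psi> i \<tau> + q * c"
proof -
  let ?M = "\<lambda>\<chi> j. Min ((\<lambda>u. p * h i j \<tau> u + q * \<chi> j u) ` L)"
  have "?M \<phi> j \<le> ?M \<psi> j + q * c" if "j \<in> nbrs V E i" for j
  proof (rule Min_image_le_add)
    fix u assume "u \<in> L"
    then have "q * \<phi> j u \<le> q * (\<psi> j u + c)"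
      using that dominated \<open>0 \<le> q\<close> by (intro mult_left_mono) (auto simp: nbrs_def)
    then show "p * h i j \<tau> u + q * \<phi> j u \<le> p * h i j \<tau> u + q * \<psi> j u + q * c"
      by (simp add: distrib_left)
  qed (use assms(1,4) in auto)
  then have "(\<Sum>j\<in>nbrs V E i. w i j * ?M \<phi> j) \<le> (\<Sum>j\<in>nbrs V E i. w i j * ?M \<psi> j) + q * c"
    using weight_nonneg sum_weights \<open>i \<in> V\<close> by (intro weighted_average_le_add)
  then show ?thesis
    using assms(3,4) by (simp add: S_map_apply)
qed

lemma S_map_comparison_principle:
  assumes "finite V" and "finite L" and "0 \<le> q" and "q < 1"
    and subsolution: "\<And>i \<tau>. i \<in> V \<Longrightarrow> \<tau> \<in> L \<Longrightarrow> \<phi> i \<tau> \<le> S_map V E L g h p q w \<phi> i \<tau>"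
    and supersolution: "\<And>i \<tau>. i \<in> V \<Longrightarrow> \<tau> \<in> L \<Longrightarrow> S_map V E L g h p q w \<psi> i \<tau> \<le> \<psi> i \<tau>"
    and "i \<in> V" and "\<tau> \<in> L"
  shows "\<phi> i \<tau> \<le> \<psi> i \<tau>"
proof -
  define D where "D = (\<lambda>(j, u). \<phi> j u - \<psi> j u) ` (V \<times> L)"
  have "finite D" and "D \<noteq> {}"
    using assms(1,2,7,8) by (auto simp: D_def)
  have le_Max: "\<phi> j u - \<psi> j u \<le> Max D" if "j \<in> V" "u \<in> L" for j u
    using \<open>finite D\<close> that by (intro Max_ge) (auto simp: D_def)
  have "\<phi> j u - \<psi> j u \<le> q * Max D" if "j \<in> V" "u \<in> L" for j u
  proof -
    have "\<phi> j u \<le> S_map V E L g h p q w \<phi> j u"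
      using subsolution that .
    also have "\<dots> \<le> S_map V E L g h p q w \<psi> j u + q * Max D"
      using assms(2,3) that le_Max by (intro S_map_le_add) (auto simp: algebra_simps)
    also have "\<dots> \<le> \<psi> j u + q * Max D"
      using supersolution[OF that] by simp
    finally show ?thesis
      by simp
  qed
  then have "Max D \<le> q * Max D"
    using \<open>finite D\<close> \<open>D \<noteq> {}\<close> by (subst Max_le_iff) (auto simp: D_def)
  then have "Max D \<le> 0"
    using \<open>q < 1\<close> mult_le_cancel_right1[of "Max D" q] by auto
  then show ?thesis
    using le_Max assms(7,8) by fastforce
qed

end

locale labelling_problem =
  fixes V :: "nat set" and E :: "nat set set" and L :: "'l set"
    and g :: "nat \<Rightarrow> 'l \<Rightarrow> real" and h :: "nat \<Rightarrow> nat \<Rightarrow> 'l \<Rightarrow> 'l \<Rightarrow> real"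
  assumes finite_vertices: "finite V" and finite_labels: "finite L"
    and simple_graph: "simple_graph V E"
    and vertex_cost_nonneg: "i \<in> V \<Longrightarrow> a \<in> L \<Longrightarrow> 0 \<le> g i a"
    and edge_cost_nonneg: "{i, j} \<in> E \<Longrightarrow> a \<in> L \<Longrightarrow> b \<in> L \<Longrightarrow> 0 \<le> h i j a b"
    and edge_cost_sym: "{i, j} \<in> E \<Longrightarrow> a \<in> L \<Longrightarrow> b \<in> L \<Longrightarrow> h i j a b = h j i b a"
begin

lemma edge_cost_le_sum:
  assumes labelling: "x \<in> V \<rightarrow> L" and "{i, j} \<in> E"
  shows "h i j (x i) (x j) \<le> (\<Sum>(k, l)\<in>{(k, l). k < l \<and> {k, l} \<in> E}. h k l (x k) (x l))"
    (is "_ \<le> (\<Sum>(k, l)\<in>?P. _)")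
proof -
  have label: "x k \<in> L" "x l \<in> L" if "{k, l} \<in> E" for k l
    using simple_graph_edgeD[OF simple_graph that] labelling by auto
  obtain k l where "(k, l) \<in> ?P" and same_cost: "h i j (x i) (x j) = h k l (x k) (x l)"
  proof (cases i j rule: linorder_cases)
    case less
    with \<open>{i, j} \<in> E\<close> show thesis
      using that by blast
  next
    case equal
    with simple_graph_edgeD(3)[OF simple_graph \<open>{i, j} \<in> E\<close>] show thesis
      by simp
  next
    case greater
    with \<open>{i, j} \<in> E\<close> have "(j, i) \<in> ?P"
      by (simp add: insert_commute)
    then show thesis
      using that edge_cost_sym[OF \<open>{i, j} \<in> E\<close> label[OF \<open>{i, j} \<in> E\<close>]] by blast
  qed
  have "?P \<subseteq> V \<times> V"
    using simple_graph_edgeD[OF simple_graph] by auto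
  then have "finite ?P"
    using finite_vertices by (auto intro: finite_subset)
  then have "(\<lambda>(k, l). h k l (x k) (x l)) (k, l) \<le> (\<Sum>(k, l)\<in>?P. h k l (x k) (x l))"
    using \<open>(k, l) \<in> ?P\<close> edge_cost_nonneg label by (intro member_le_sum) auto
  then show ?thesis
    by (simp add: same_cost)
qed

lemma local_cost_le_energy:
  assumes labelling: "x \<in> V \<rightarrow> L" and "{i, j} \<in> E"
  shows "g i (x i) + h i j (x i) (x j) \<le> energy V E g h x"
proof -
  have "i \<in> V"
    using simple_graph_edgeD(1)[OF simple_graph \<open>{i, j} \<in> E\<close>] .
  then have "g i (x i) \<le> (\<Sum>k\<in>V. g k (x k))"
    using finite_vertices vertex_cost_nonneg labelling by (intro member_le_sum) auto
  then show ?thesis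
    unfolding energy_def using edge_cost_le_sum[OF assms] by (rule add_mono)
qed

lemma finite_constrained_energies: "finite {energy V E g h x | x. x \<in> V \<rightarrow>\<^sub>E L \<and> x i = \<tau>}"
proof (rule finite_subset)
  show "finite (energy V E g h ` (V \<rightarrow>\<^sub>E L))"
    using finite_vertices finite_labels by (intro finite_imageI finite_PiE) auto
qed blast

lemma value_fun_le_energy:
  assumes "x \<in> V \<rightarrow>\<^sub>E L"
  shows "value_fun V E L g h i (x i) \<le> energy V E g h x"
  unfolding value_fun_def using finite_constrained_energies assms by (intro Min_le) auto

lemma value_fun_attained:
  assumes "i \<in> V" and "\<tau> \<in> L"
  obtains x where "x \<in> V \<rightarrow>\<^sub>E L" and "x i = \<tau>" and "value_fun V E L g h i \<tau> = energy V E g h x"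
proof -
  have "(\<lambda>k\<in>V. \<tau>) \<in> V \<rightarrow>\<^sub>E L" and "(\<lambda>k\<in>V. \<tau>) i = \<tau>"
    using assms by auto
  then have "{energy V E g h x | x. x \<in> V \<rightarrow>\<^sub>E L \<and> x i = \<tau>} \<noteq> {}"
    by blast
  from Min_in[OF finite_constrained_energies this] show thesis
    using that unfolding value_fun_def by blast
qed

end

locale weighted_labelling_problem = labelling_problem + averaging_weights
begin

lemma S_map_zero_nonneg:
  assumes "0 \<le> p" and "i \<in> V" and "\<tau> \<in> L"
  shows "0 \<le> S_map V E L g h p q w (\<lambda>_ _. 0) i \<tau>"
proof -
  have "0 \<le> Min ((\<lambda>u. p * h i j \<tau> u) ` L)" if "j \<in> nbrs V E i" for j
    using that assms finite_labels edge_cost_nonneg by (subst Min_ge_iff) (auto simp: nbrs_def)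
  then show ?thesis
    using assms vertex_cost_nonneg weight_nonneg by (simp add: S_map_apply sum_nonneg)
qed

lemma S_map_value_fun_le:
  assumes "0 \<le> p" and "0 \<le> q" and "p + q = 1" and "i \<in> V" and "\<tau> \<in> L"
  shows "S_map V E L g h p q w (value_fun V E L g h) i \<tau> \<le> value_fun V E L g h i \<tau>"
proof -
  let ?f = "value_fun V E L g h"
  obtain x where labelling: "x \<in> V \<rightarrow>\<^sub>E L" and "x i = \<tau>" and attained: "?f i \<tau> = energy V E g h x"
    using value_fun_attained assms(4,5) .
  let ?F = "energy V E g h x"
  have "Min ((\<lambda>u. p * h i j \<tau> u + q * ?f j u) ` L) \<le> ?F - p * g i \<tau>"
    if "j \<in> nbrs V E i" for j
  proof -
    from that have "j \<in> V" and "{i, j} \<in> E"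
      by (auto simp: nbrs_def)
    have "Min ((\<lambda>u. p * h i j \<tau> u + q * ?f j u) ` L) \<le> p * h i j \<tau> (x j) + q * ?f j (x j)"
      using finite_labels labelling \<open>j \<in> V\<close> by (intro Min_le) auto
    also have "\<dots> \<le> p * (?F - g i \<tau>) + q * ?F"
    proof (intro add_mono mult_left_mono)
      show "h i j \<tau> (x j) \<le> ?F - g i \<tau>"
        using local_cost_le_energy[of x i j] labelling \<open>x i = \<tau>\<close> \<open>{i, j} \<in> E\<close>
        by (auto simp: PiE_def)
    qed (use assms(1,2) value_fun_le_energy[OF labelling] in auto)
    also have "\<dots> = (p + q) * ?F - p * g i \<tau>"
      by (simp add: algebra_simps)
    finally show ?thesis
      using assms(3) by simp
  qed
  then have "(\<Sum>j\<in>nbrs V E i. w i j * Min ((\<lambda>u. p * h i j \<tau> u + q * ?f j u) ` L))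
      \<le> ?F - p * g i \<tau>"
    using weighted_average_le_add[of "nbrs V E i" "w i" _ "\<lambda>_. 0" "?F - p * g i \<tau>"]
      weight_nonneg sum_weights assms(4) by simp
  then show ?thesis
    using assms(4,5) attained by (simp add: S_map_apply)
qed

end

theorem theorem5:
  fixes n :: nat and V :: "nat set" and E :: "nat set set" and L :: "'l set"
    and g :: "nat \<Rightarrow> 'l \<Rightarrow> real" and h :: "nat \<Rightarrow> nat \<Rightarrow> 'l \<Rightarrow> 'l \<Rightarrow> real"
    and p q :: real and w :: "nat \<Rightarrow> nat \<Rightarrow> real" and \<phi> :: "nat \<Rightarrow> 'l \<Rightarrow> real"
  assumes "n \<ge> 2" and "V = {1..n}"
    and "simple_graph V E" and "connected_graph V E"
    and "finite L"
    and "\<forall>i\<in>V. \<forall>a\<in>L. g i a \<ge> 0"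
    and "\<forall>i j. {i, j} \<in> E \<longrightarrow> (\<forall>a\<in>L. \<forall>b\<in>L. h i j a b \<ge> 0)"
    and "\<forall>i j. {i, j} \<in> E \<longrightarrow> (\<forall>a\<in>L. \<forall>b\<in>L. h i j a b = h j i b a)"
    and "0 < p" and "p < 1" and "q = 1 - p"
    and "\<forall>i\<in>V. \<forall>j\<in>nbrs V E i. 0 \<le> w i j \<and> w i j \<le> 1"
    and "\<forall>i\<in>V. (\<Sum>j\<in>nbrs V E i. w i j) = 1"
    and "\<phi> \<in> tuples V L" and "S_map V E L g h p q w \<phi> = \<phi>"
  shows "\<forall>i\<in>V. \<forall>\<tau>\<in>L. 0 \<le> \<phi> i \<tau> \<and> \<phi> i \<tau> \<le> value_fun V E L g h i \<tau>"
proof (intro ballI conjI)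
  interpret weighted_labelling_problem V E L g h w
    by unfold_locales (use assms in \<open>(simp; fail) | blast\<close>)+
  fix i \<tau> assume "i \<in> V" and "\<tau> \<in> L"
  note comparison = S_map_comparison_principle[where L = L and g = g and h = h and p = p and q = q]
  show "0 \<le> \<phi> i \<tau>"
    by (rule comparison[where \<phi> = "\<lambda>_ _. 0"])
      (use assms finite_vertices S_map_zero_nonneg \<open>i \<in> V\<close> \<open>\<tau> \<in> L\<close> in auto)
  show "\<phi> i \<tau> \<le> value_fun V E L g h i \<tau>"
    by (rule comparison)
      (use assms finite_vertices S_map_value_fun_le \<open>i \<in> V\<close> \<open>\<tau> \<in> L\<close> in auto)
qed

end
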